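(* Let $\lambda_1$ be the smallest eigenvalue of the discrete elliptic operator $A$ on the finite element space $V^h$, let $\varphi_1$ be the corresponding normalized eigenfunction, and put $\widetilde{A} := A - \lambda_1 I$. Let $\tau>0$, let $N$ be a positive integer with $N\tau = T$, let $t^n = n\tau$, let $\sigma$ be a constant weight with $0<\sigma\le 1$, and let $w^0\in V^h$. Consider the two-level difference scheme for $y^n\in V^h$, $n=0,1,\dots,N$: $$\frac{\exp(\lambda_1\tau)\,y^{n+1}-y^n}{\tau}+\widetilde{A}\big(\sigma\exp(\lambda_1\tau)\,y^{n+1}+(1-\sigma)\,y^n\big)=0,\quad n=0,1,\dots,N-1,\qquad y^0=w^0 .$$ Then this scheme is a fundamental mode exact scheme, i.e. $y_1^{n+1}=\exp(-\lambda_1\tau)\,y_1^n$ for $n=0,1,\dots,N-1$, where $y_1^n=(y^n,\varphi_1)$. Moreover, if $\sigma\ge 0.5$, the scheme is unconditionally stable (with no restriction on the time step $\tau>0$) and the estimate $$\|y^{n+1}\|\le \exp(-\lambda_1 t^{n+1})\,\|w^0\|,\quad n=0,1,\dots,N-1,$$ holds.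
   Context: Setting. $\Omega\subset\mathbb{R}^d$, $d=2,3$, is a bounded domain with piecewise smooth boundary $\partial\Omega$; $(u,v)=\int_\Omega uv\,d\boldsymbol{x}$ and $\|u\|=(u,u)^{1/2}$ are the scalar product and norm in $L_2(\Omega)$ (real-valued functions). The coefficients $k(\boldsymbol{x}),c(\boldsymbol{x}),\mu(\boldsymbol{x})$ are smooth functions on $\overline\Omega$ with $k\ge\kappa>0$ ($\kappa$ a constant) and $\mu\ge0$. The bilinear form $$a(u,v)=\int_\Omega\big(k\nabla u\cdot\nabla v+c\,u\,v\big)\,d\boldsymbol{x}+\int_{\partial\Omega}\mu\,u\,v\,d\boldsymbol{x}$$ on $H^1(\Omega)$ is symmetric and satisfies $a(u,u)\ge\delta\|u\|^2$ with a constant $\delta$ (of arbitrary sign). $V^h\subset H^1(\Omega)$ is a finite-dimensional (finite element) subspace of dimension $M_h$, equipped with the $L_2(\Omega)$ scalar product and norm. The discrete elliptic operator $A:V^h\to V^h$ is defined by $(Ay,v)=a(y,v)$ for all $y,v\in V^h$; it is self-adjoint. $I$ is the identity operator. The eigenvalues of $A$ are $\lambda_1\le\lambda_2\le\dots\le\lambda_{M_h}$, with $A\varphi_k=\lambda_k\varphi_k$, where the eigenfunctions $\varphi_1,\dots,\varphi_{M_h}$ form an orthonormal basis of $V^h$; for $y\in V^h$ one writes $y=\sum_{k=1}^{M_h}y_k\varphi_k$, $y_k=(y,\varphi_k)$. The scheme approximates the Cauchy problem $\frac{dw}{dt}+Aw=0$, $0<t\le T$, $w(0)=w^0$, on a uniform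 time grid with step $\tau$, where $w^0\in V^h$ is the $L_2$-projection onto $V^h$ of an initial function $u^0\in L_2(\Omega)$. Definition. A two-level scheme for this problem, with solution $y^n=\sum_k y_k^n\varphi_k$, is called a fundamental mode exact scheme if $y_1^{n+1}=\exp(-\lambda_1\tau)\,y_1^n$ for all $n=0,1,\dots,N-1$. *)

theory Defs
  imports "HOL-Analysis.Analysis"
begin

definition square_integrable :: "('a::euclidean_space \<Rightarrow> real) \<Rightarrow> bool" where
  "square_integrable f \<longleftrightarrow> f \<in> borel_measurable lborel \<and> integrable lborel (\<lambda>x. (f x)\<^sup>2)"

lemma square_integrable_mult:
  assumes "square_integrable f" "square_integrable g"
  shows "integrable lborel (\<lambda>x. f x * g x)"
proof (rule Bochner_Integration.integrable_bound)
  show "integrable lborel (\<lambda>x. (f x)\<^sup>2 + (g x)\<^sup>2)"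
    using assms by (simp add: square_integrable_def)
  show "(\<lambda>x. f x * g x) \<in> borel_measurable lborel"
    using assms unfolding square_integrable_def by (intro borel_measurable_times) simp_all
  have "\<bar>a * b\<bar> \<le> a\<^sup>2 + b\<^sup>2" for a b :: real
  proof -
    have "0 \<le> (\<bar>a\<bar> - \<bar>b\<bar>)\<^sup>2" by simp
    then have "2 * (\<bar>a\<bar> * \<bar>b\<bar>) \<le> a\<^sup>2 + b\<^sup>2" by (simp add: power2_diff)
    moreover have "0 \<le> \<bar>a\<bar> * \<bar>b\<bar>" by simp
    ultimately show ?thesis unfolding abs_mult by linarith
  qed
  then show "AE x in lborel. norm (f x * g x) \<le> norm ((f x)\<^sup>2 + (g x)\<^sup>2)"
    by simp
qed

lemma square_integrable_add:
  assumes "square_integrable f" "square_integrable g"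
  shows "square_integrable (\<lambda>x. f x + g x)"
  using assms square_integrable_mult[OF assms]
  by (auto simp: square_integrable_def power2_sum mult.assoc)

lemma square_integrable_scale:
  "square_integrable f \<Longrightarrow> square_integrable (\<lambda>x. r * f x)"
  by (auto simp: square_integrable_def power_mult_distrib)

lemma square_integrable_diff:
  assumes "square_integrable f" "square_integrable g"
  shows "square_integrable (\<lambda>x. f x - g x)"
  using square_integrable_add[OF assms(1) square_integrable_scale[OF assms(2), of "-1"]] by simp

definition ae_eq :: "('a::euclidean_space \<Rightarrow> real) \<Rightarrow> ('a \<Rightarrow> real) \<Rightarrow> bool" where
  "ae_eq f g \<longleftrightarrow> square_integrable f \<and> square_integrable g \<and> (AE x in lborel. f x = g x)"

lemma square_integrable_zero: "square_integrable (\<lambda>_. 0)"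
  by (simp add: square_integrable_def)

quotient_type (overloaded) 'a L2 = "'a::euclidean_space \<Rightarrow> real" / partial: ae_eq
proof (rule part_equivpI)
  show "\<exists>x::'a \<Rightarrow> real. ae_eq x x"
    by (rule exI[of _ "\<lambda>_. 0"]) (simp add: ae_eq_def square_integrable_zero)
  show "symp (ae_eq :: ('a \<Rightarrow> real) \<Rightarrow> _)"
    by (rule sympI) (auto simp: ae_eq_def)
  show "transp (ae_eq :: ('a \<Rightarrow> real) \<Rightarrow> _)"
    by (rule transpI) (auto simp: ae_eq_def)
qed

instantiation L2 :: (euclidean_space) real_vector
begin

lift_definition zero_L2 :: "'a L2" is "\<lambda>_. 0"
  by (simp add: ae_eq_def square_integrable_zero)

lift_definition plus_L2 :: "'a L2 \<Rightarrow> 'a L2 \<Rightarrow> 'a L2" is "\<lambda>f g x. f x + g x"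
  by (auto simp: ae_eq_def intro: square_integrable_add)

lift_definition scaleR_L2 :: "real \<Rightarrow> 'a L2 \<Rightarrow> 'a L2" is "\<lambda>r f x. r * f x"
  by (auto simp: ae_eq_def intro: square_integrable_scale)

lift_definition uminus_L2 :: "'a L2 \<Rightarrow> 'a L2" is "\<lambda>f x. - f x"
  by (auto simp: ae_eq_def square_integrable_def)

lift_definition minus_L2 :: "'a L2 \<Rightarrow> 'a L2 \<Rightarrow> 'a L2" is "\<lambda>f g x. f x - g x"
  by (auto simp: ae_eq_def intro: square_integrable_diff)

instance
proof
  fix u v w :: "'a L2" and r s :: real
  show "u + v + w = u + (v + w)"
    by transfer (auto simp: ae_eq_def add.assoc intro!: square_integrable_add)
  show "u + v = v + u"
    by transfer (auto simp: ae_eq_def add.commute intro!: square_integrable_add)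
  show "0 + u = u"
    by transfer (auto simp: ae_eq_def)
  show "- u + u = 0"
    by transfer (auto simp: ae_eq_def square_integrable_zero)
  show "u - v = u + - v"
    by transfer (auto simp: ae_eq_def intro: square_integrable_diff)
  show "r *\<^sub>R (u + v) = r *\<^sub>R u + r *\<^sub>R v"
    by transfer (auto simp: ae_eq_def distrib_left
        intro!: square_integrable_add square_integrable_scale)
  show "(r + s) *\<^sub>R u = r *\<^sub>R u + s *\<^sub>R u"
    by transfer (auto simp: ae_eq_def distrib_right
        intro!: square_integrable_add square_integrable_scale)
  show "r *\<^sub>R s *\<^sub>R u = (r * s) *\<^sub>R u"
    by transfer (auto simp: ae_eq_def mult.assoc[symmetric] intro!: square_integrable_scale)
  show "1 *\<^sub>R u = u"
    by transfer (auto simp: ae_eq_def)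
qed

end

instantiation L2 :: (euclidean_space) real_inner
begin

lift_definition inner_L2 :: "'a L2 \<Rightarrow> 'a L2 \<Rightarrow> real" is "\<lambda>f g. LINT x|lborel. f x * g x"
proof -
  fix f f' g g' :: "'a \<Rightarrow> real"
  assume "ae_eq f f'" "ae_eq g g'"
  then show "(LINT x|lborel. f x * g x) = (LINT x|lborel. f' x * g' x)"
    by (intro integral_cong_AE) (auto simp: ae_eq_def square_integrable_def)
qed

definition norm_L2_def:
  "norm u = sqrt (inner u (u :: 'a L2))"

definition sgn_L2_def:
  "sgn u = (u :: 'a L2) /\<^sub>R norm u"

definition dist_L2_def:
  "dist u v = norm (u - v :: 'a L2)"

definition uniformity_L2_def:
  "(uniformity :: ('a L2 \<times> 'a L2) filter) = (INF e\<in>{0<..}. principal {(u, v). dist u v < e})"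

definition open_L2_def:
  "open U \<longleftrightarrow> (\<forall>u\<in>(U :: 'a L2 set). eventually (\<lambda>(u', v). u' = u \<longrightarrow> v \<in> U) uniformity)"

instance
proof
  fix u v w :: "'a L2" and r :: real
  show "inner u v = inner v u"
    by transfer (simp add: mult.commute)
  show "inner (u + v) w = inner u w + inner v w"
    by transfer (simp add: ae_eq_def distrib_right square_integrable_mult)
  show "inner (r *\<^sub>R u) v = r * inner u v"
    by transfer (simp add: mult.assoc)
  show "0 \<le> inner u u"
    by transfer simp
  show "inner u u = 0 \<longleftrightarrow> u = 0"
  proof transfer
    fix f :: "'a \<Rightarrow> real"
    assume f: "ae_eq f f"
    then have "integrable lborel (\<lambda>x. f x * f x)"
      by (simp add: ae_eq_def square_integrable_mult)
    then have "(LINT x|lborel. f x * f x) = 0 \<longleftrightarrow> (AE x in lborel. f x * f x = 0)"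
      by (intro integral_nonneg_eq_0_iff_AE) auto
    with f show "(LINT x|lborel. f x * f x) = 0 \<longleftrightarrow> ae_eq f (\<lambda>_. 0)"
      by (simp add: ae_eq_def square_integrable_zero)
  qed
  show "norm u = sqrt (inner u u)"
    by (rule norm_L2_def)
  show "sgn u = u /\<^sub>R norm u"
    by (rule sgn_L2_def)
  show "dist u v = norm (u - v)"
    by (rule dist_L2_def)
  show "(uniformity :: ('a L2 \<times> 'a L2) filter) = (INF e\<in>{0<..}. principal {(u, v). dist u v < e})"
    by (rule uniformity_L2_def)
  show "open U \<longleftrightarrow> (\<forall>u\<in>U. eventually (\<lambda>(u', v). u' = u \<longrightarrow> v \<in> U) uniformity)"
    for U :: "'a L2 set"
    by (rule open_L2_def)
qed

end

text \<open>
  A function on \<open>\<Omega>\<close> is identified with its extension by zero, so that the scalar product and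
  norm of \<open>L\<^sub>2(\<Omega>)\<close> are those of the type \<open>L2\<close>.
\<close>

definition L2_on :: "'a::euclidean_space set \<Rightarrow> 'a L2 set" where
  "L2_on \<Omega> = {u. AE x in lborel. x \<notin> \<Omega> \<longrightarrow> rep_L2 u x = 0}"

primrec Ck_on :: "nat \<Rightarrow> ('a::euclidean_space \<Rightarrow> real) \<Rightarrow> 'a set \<Rightarrow> bool" where
  "Ck_on 0 f U \<longleftrightarrow> continuous_on U f"
| "Ck_on (Suc n) f U \<longleftrightarrow>
     (\<exists>D. (\<forall>x\<in>U. (f has_derivative (\<lambda>h. \<Sum>b\<in>Basis. (h \<bullet> b) * D b x)) (at x)) \<and>
          (\<forall>b\<in>Basis. Ck_on n (D b) U))"

text \<open>Smooth functions on an arbitrary set are the restrictions of \<open>C\<^sup>\<infinity>\<close> functions defined on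
  an open neighbourhood.\<close>

definition smooth_fun_on :: "'a::euclidean_space set \<Rightarrow> ('a \<Rightarrow> real) \<Rightarrow> bool" where
  "smooth_fun_on S f \<longleftrightarrow>
     (\<exists>U g. open U \<and> S \<subseteq> U \<and> (\<forall>n. Ck_on n g U) \<and> (\<forall>x\<in>S. f x = g x))"

definition partial_deriv :: "'a::euclidean_space \<Rightarrow> ('a \<Rightarrow> real) \<Rightarrow> 'a \<Rightarrow> real" where
  "partial_deriv b f x = frechet_derivative f (at x) b"

definition test_function :: "'a::euclidean_space set \<Rightarrow> ('a \<Rightarrow> real) \<Rightarrow> bool" where
  "test_function \<Omega> \<psi> \<longleftrightarrow>
     smooth_fun_on UNIV \<psi> \<and> compact (closure {x. \<psi> x \<noteq> 0}) \<and> closure {x. \<psi> x \<noteq> 0} \<subseteq> \<Omega>"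

definition has_weak_deriv :: "'a::euclidean_space set \<Rightarrow> 'a \<Rightarrow> 'a L2 \<Rightarrow> 'a L2 \<Rightarrow> bool" where
  "has_weak_deriv \<Omega> b u v \<longleftrightarrow> v \<in> L2_on \<Omega> \<and>
     (\<forall>\<psi>. test_function \<Omega> \<psi> \<longrightarrow>
        (LINT x:\<Omega>|lborel. rep_L2 u x * partial_deriv b \<psi> x) =
        - (LINT x:\<Omega>|lborel. rep_L2 v x * \<psi> x))"

definition weak_deriv :: "'a::euclidean_space set \<Rightarrow> 'a \<Rightarrow> 'a L2 \<Rightarrow> 'a L2" where
  "weak_deriv \<Omega> b u = (THE v. has_weak_deriv \<Omega> b u v)"

definition H1 :: "'a::euclidean_space set \<Rightarrow> 'a L2 set" where
  "H1 \<Omega> = {u \<in> L2_on \<Omega>. \<forall>b\<in>Basis. \<exists>v. has_weak_deriv \<Omega> b u v}"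

text \<open>
  The surface measure is the Hausdorff measure of dimension \<open>m = d - 1 \<ge> 1\<close>, normalised so that
  it agrees with surface area. The set function below is a metric outer measure, hence countably
  additive on the Borel sets. (As \<open>m \<ge> 1\<close>, empty covering sets contribute zero.)
\<close>

definition hausdorff_content :: "nat \<Rightarrow> real \<Rightarrow> 'a::metric_space set \<Rightarrow> ennreal" where
  "hausdorff_content m \<epsilon> E =
     (INF C \<in> {C :: nat \<Rightarrow> 'a set. E \<subseteq> (\<Union>i. C i) \<and> (\<forall>i. bounded (C i) \<and> diameter (C i) \<le> \<epsilon>)}.
        (\<Sum>i. ennreal (unit_ball_vol (real m) * (diameter (C i) / 2) ^ m)))"

definition hausdorff_measure :: "nat \<Rightarrow> 'a::metric_space measure" where
  "hausdorff_measure m =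
     measure_of UNIV (sets borel) (\<lambda>E. SUP \<epsilon>\<in>{0<..}. hausdorff_content m \<epsilon> E)"

definition surface_measure :: "'a::euclidean_space measure" where
  "surface_measure = hausdorff_measure (DIM('a) - 1)"

definition smooth_hypersurface :: "'a::euclidean_space set \<Rightarrow> bool" where
  "smooth_hypersurface P \<longleftrightarrow>
     (\<forall>p\<in>P. \<exists>U g. open U \<and> p \<in> U \<and> smooth_fun_on U g \<and>
        (\<forall>x\<in>U. \<exists>b\<in>Basis. partial_deriv b g x \<noteq> 0) \<and>
        P \<inter> U = {x\<in>U. g x = 0})"

text \<open>
  The boundary consists of finitely many connected smooth pieces of finite area (relatively open,
  i.e. without their edges) together with their edges, which have zero area.
\<close>

definition piecewise_smooth_boundary :: "'a::euclidean_space set \<Rightarrow> bool" where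
  "piecewise_smooth_boundary \<Omega> \<longleftrightarrow>
     (\<exists>F. finite F \<and> disjoint F \<and> frontier \<Omega> = (\<Union>P\<in>F. closure P) \<and>
        (\<forall>P\<in>F. connected P \<and> smooth_hypersurface P \<and>
           emeasure surface_measure P < \<infinity> \<and>
           emeasure surface_measure (closure P - P) = 0))"

definition bounded_domain :: "'a::euclidean_space set \<Rightarrow> bool" where
  "bounded_domain \<Omega> \<longleftrightarrow> \<Omega> \<noteq> {} \<and> open \<Omega> \<and> connected \<Omega> \<and> bounded \<Omega>"

text \<open>
  The trace of \<open>u\<close> is the \<open>L\<^sub>2(\<partial>\<Omega>)\<close> limit of the boundary values of functions smooth on the
  closure of \<open>\<Omega>\<close> that converge to \<open>u\<close> in \<open>H\<^sup>1(\<Omega>)\<close>. On domains admitting a trace theorem (e.g.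
  Lipschitz ones) it exists and is unique up to sets of surface measure zero.
\<close>

definition has_trace :: "'a::euclidean_space set \<Rightarrow> 'a L2 \<Rightarrow> ('a \<Rightarrow> real) \<Rightarrow> bool" where
  "has_trace \<Omega> u g \<longleftrightarrow>
     g \<in> borel_measurable borel \<and>
     (\<integral>\<^sup>+x\<in>frontier \<Omega>. ennreal ((g x)\<^sup>2) \<partial>surface_measure) < \<infinity> \<and>
     (\<exists>f. (\<forall>j::nat. smooth_fun_on (closure \<Omega>) (f j)) \<and>
        (\<lambda>j. \<integral>\<^sup>+x\<in>\<Omega>. ennreal ((f j x - rep_L2 u x)\<^sup>2) \<partial>lborel) \<longlonglongrightarrow> 0 \<and>
        (\<forall>b\<in>Basis. (\<lambda>j. \<integral>\<^sup>+x\<in>\<Omega>. ennreal ((partial_deriv b (f j) x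
            - rep_L2 (weak_deriv \<Omega> b u) x)\<^sup>2) \<partial>lborel) \<longlonglongrightarrow> 0) \<and>
        (\<lambda>j. \<integral>\<^sup>+x\<in>frontier \<Omega>. ennreal ((f j x - g x)\<^sup>2) \<partial>surface_measure) \<longlonglongrightarrow> 0)"

definition trace_of :: "'a::euclidean_space set \<Rightarrow> 'a L2 \<Rightarrow> 'a \<Rightarrow> real" where
  "trace_of \<Omega> u = (SOME g. has_trace \<Omega> u g)"

definition bilinear_form ::
  "'a::euclidean_space set \<Rightarrow> ('a \<Rightarrow> real) \<Rightarrow> ('a \<Rightarrow> real) \<Rightarrow> ('a \<Rightarrow> real) \<Rightarrow> 'a L2 \<Rightarrow> 'a L2 \<Rightarrow> real"
where
  "bilinear_form \<Omega> k c \<mu> u v =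
     (LINT x:\<Omega>|lborel.
        k x * (\<Sum>b\<in>Basis. rep_L2 (weak_deriv \<Omega> b u) x * rep_L2 (weak_deriv \<Omega> b v) x)
        + c x * rep_L2 u x * rep_L2 v x)
     + (LINT x:frontier \<Omega>|surface_measure. \<mu> x * trace_of \<Omega> u x * trace_of \<Omega> v x)"

definition subspace_of_dim :: "nat \<Rightarrow> 'v::real_vector set \<Rightarrow> bool" where
  "subspace_of_dim M V \<longleftrightarrow> (\<exists>B. finite B \<and> card B = M \<and> independent B \<and> span B = V)"

definition represents_form_on ::
  "'v::real_inner set \<Rightarrow> ('v \<Rightarrow> 'v \<Rightarrow> real) \<Rightarrow> ('v \<Rightarrow> 'v) \<Rightarrow> bool" where
  "represents_form_on V a A \<longleftrightarrow> (\<forall>y\<in>V. A y \<in> V \<and> (\<forall>v\<in>V. inner (A y) v = a y v))"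

definition eigenpair_on :: "'v::real_vector set \<Rightarrow> ('v \<Rightarrow> 'v) \<Rightarrow> real \<Rightarrow> 'v \<Rightarrow> bool" where
  "eigenpair_on V A l \<phi> \<longleftrightarrow> \<phi> \<in> V \<and> \<phi> \<noteq> 0 \<and> A \<phi> = l *\<^sub>R \<phi>"

definition smallest_eigenvalue_on :: "'v::real_vector set \<Rightarrow> ('v \<Rightarrow> 'v) \<Rightarrow> real \<Rightarrow> bool" where
  "smallest_eigenvalue_on V A l \<longleftrightarrow>
     (\<exists>\<phi>. eigenpair_on V A l \<phi>) \<and> (\<forall>l' \<phi>. eigenpair_on V A l' \<phi> \<longrightarrow> l \<le> l')"

text \<open>A difference scheme is represented by the set of its solutions on the grid \<open>0, \<dots>, N\<close>.\<close>

definition fm_scheme ::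
  "'v::real_vector set \<Rightarrow> ('v \<Rightarrow> 'v) \<Rightarrow> real \<Rightarrow> real \<Rightarrow> real \<Rightarrow> nat \<Rightarrow> 'v \<Rightarrow> (nat \<Rightarrow> 'v) set" where
  "fm_scheme V A lam\<^sub>1 \<sigma> \<tau> N w\<^sub>0 =
     (let A' = (\<lambda>y. A y - lam\<^sub>1 *\<^sub>R y)
      in {y. (\<forall>n\<le>N. y n \<in> V) \<and> y 0 = w\<^sub>0 \<and>
           (\<forall>n<N. (exp (lam\<^sub>1 * \<tau>) *\<^sub>R y (Suc n) - y n) /\<^sub>R \<tau>
              + A' ((\<sigma> * exp (lam\<^sub>1 * \<tau>)) *\<^sub>R y (Suc n) + (1 - \<sigma>) *\<^sub>R y n) = 0)})"

definition fundamental_mode_exact ::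
  "real \<Rightarrow> 'v::real_inner \<Rightarrow> real \<Rightarrow> nat \<Rightarrow> (nat \<Rightarrow> 'v) set \<Rightarrow> bool" where
  "fundamental_mode_exact lam\<^sub>1 \<phi>\<^sub>1 \<tau> N S \<longleftrightarrow>
     (\<forall>y\<in>S. \<forall>n<N. inner (y (Suc n)) \<phi>\<^sub>1 = exp (- lam\<^sub>1 * \<tau>) * inner (y n) \<phi>\<^sub>1)"

text \<open>
  Stability with respect to the initial data on \<open>[0, T]\<close>, with a constant that is independent of
  the time step and without any upper bound on the latter. Here \<open>S \<tau> N w\<close> is the set of solutions
  with time step \<open>\<tau>\<close>, \<open>N\<close> steps and initial value \<open>w\<close>.
\<close>

definition unconditionally_stable ::
  "'v::real_normed_vector set \<Rightarrow> real \<Rightarrow> (real \<Rightarrow> nat \<Rightarrow> 'v \<Rightarrow> (nat \<Rightarrow> 'v) set) \<Rightarrow> bool" where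
  "unconditionally_stable V T S \<longleftrightarrow>
     (\<exists>C. \<forall>\<tau> N. 0 < \<tau> \<longrightarrow> 0 < N \<longrightarrow> real N * \<tau> = T \<longrightarrow>
        (\<forall>w\<in>V. \<forall>y\<in>S \<tau> N w. \<forall>n\<le>N. norm (y n) \<le> C * norm w))"

end

theory Submission
  imports Defs
begin

text \<open>
  Everything rests on two properties of \<open>A\<close> on \<open>V\<close>: it is self-adjoint, and its smallest eigenvalue
  bounds its quadratic form from below.

  The formula for \<open>a(u, v)\<close> is visibly invariant under exchanging \<open>u\<close> and \<open>v\<close>, so \<open>(A x, y) = (x, A y)\<close>
  on \<open>V\<close>. An operator that is symmetric on a subspace is automatically linear there
  (\<open>symmetric_operator.linear_add\<close>, \<open>symmetric_operator.linear_scale\<close>), so self-adjointness and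
  linearity both come from the symmetry of the form.

  The bound \<open>(A x, x) \<ge> \<lambda>\<^sub>1 (x, x)\<close> is the variational characterisation of the smallest eigenvalue
  (\<open>smallest_eigenvalue_le_quadratic_form\<close>): the quadratic form attains its minimum on the unit
  sphere of \<open>V\<close>, which is compact since \<open>V\<close> is finite-dimensional, and a minimiser is an
  eigenvector.

  Write \<open>z = exp (\<lambda>\<^sub>1 \<tau>) y\<^sup>n\<^sup>+\<^sup>1\<close> and \<open>B = A - \<lambda>\<^sub>1 I\<close>, so that one step of the scheme reads
  \<open>z - y\<^sup>n + \<tau> B s = 0\<close> with \<open>s = \<sigma> z + (1 - \<sigma>) y\<^sup>n\<close>. The scalar product with \<open>\<phi>\<^sub>1\<close> annihilates the second
  term, because \<open>B \<phi>\<^sub>1 = 0\<close> and \<open>B\<close> is symmetric; this is exactness on the fundamental mode. The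
  scalar product with \<open>s\<close> gives \<open>(z - y\<^sup>n, s) \<le> 0\<close>, because \<open>B\<close> is positive semidefinite; for
  \<open>\<sigma> \<ge> 1/2\<close> this forces \<open>\<parallel>z\<parallel> \<le> \<parallel>y\<^sup>n\<parallel>\<close>, and the estimate follows by iterating over the time levels.
\<close>

section \<open>Finite-dimensional subspaces of inner product spaces\<close>

text \<open>
  Boxes with respect to a finite family are continuous images of products of intervals; they
  provide compactness in spaces that need not be complete.
\<close>

lemma compact_coefficient_box:
  fixes B :: "'v::real_normed_vector set"
  assumes "finite B"
  shows "compact {\<Sum>b\<in>B. f b *\<^sub>R b | f. \<forall>b\<in>B. \<bar>f b\<bar> \<le> (1::real)}"
  using assms
proof (induction B)
  case empty
  then show ?case by simp
next
  case (insert b B)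
  let ?K = "\<lambda>B. {\<Sum>b\<in>B. f b *\<^sub>R b | f. \<forall>b\<in>B. \<bar>f b\<bar> \<le> (1::real)}"
  have "?K (insert b B) = (\<lambda>(t, x). t *\<^sub>R b + x) ` ({-1..1} \<times> ?K B)"
  proof (intro equalityI subsetI)
    fix x assume "x \<in> ?K (insert b B)"
    then obtain f where f: "\<forall>c\<in>insert b B. \<bar>f c\<bar> \<le> 1" "x = (\<Sum>c\<in>insert b B. f c *\<^sub>R c)"
      by blast
    have "x = f b *\<^sub>R b + (\<Sum>c\<in>B. f c *\<^sub>R c)"
      using f insert by simp
    moreover have "f b \<in> {-1..1}" "(\<Sum>c\<in>B. f c *\<^sub>R c) \<in> ?K B"
      using f(1) by auto
    ultimately show "x \<in> (\<lambda>(t, x). t *\<^sub>R b + x) ` ({-1..1} \<times> ?K B)"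
      by (intro image_eqI[where x = "(f b, \<Sum>c\<in>B. f c *\<^sub>R c)"]) auto
  next
    fix x assume "x \<in> (\<lambda>(t, x). t *\<^sub>R b + x) ` ({-1..1} \<times> ?K B)"
    then obtain t u where tu: "t \<in> {-1..1}" "u \<in> ?K B" "x = t *\<^sub>R b + u"
      by (elim imageE SigmaE) simp
    then obtain f where f: "\<forall>c\<in>B. \<bar>f c\<bar> \<le> 1" "u = (\<Sum>c\<in>B. f c *\<^sub>R c)"
      by blast
    have "(\<Sum>c\<in>B. (f(b := t)) c *\<^sub>R c) = (\<Sum>c\<in>B. f c *\<^sub>R c)"
      using insert by (intro sum.cong) auto
    then have "x = (\<Sum>c\<in>insert b B. (f(b := t)) c *\<^sub>R c)"
      using insert tu(3) f(2) by simp
    moreover have "\<forall>c\<in>insert b B. \<bar>(f(b := t)) c\<bar> \<le> 1"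
      using tu(1) f(1) by auto
    ultimately show "x \<in> ?K (insert b B)" by blast
  qed
  moreover have "compact ((\<lambda>(t, x). t *\<^sub>R b + x) ` ({-1..1} \<times> ?K B))"
    using insert.IH
    by (intro compact_continuous_image compact_Times)
      (auto simp: case_prod_unfold intro!: continuous_intros)
  ultimately show ?case by simp
qed

lemma orthonormal_basis_of_span:
  fixes B :: "'v::real_inner set"
  assumes "finite B"
  obtains E where "finite E" "span E = span B" "pairwise orthogonal E" "\<And>e. e \<in> E \<Longrightarrow> norm e = 1"
proof -
  obtain C where C: "finite C" "span C = span B" "pairwise orthogonal C"
    using basis_orthogonal[OF assms] by blast
  let ?E = "(\<lambda>x. x /\<^sub>R norm x) ` (C - {0})"
  have "span ?E = span (C - {0})"
    using C(1) by (intro span_image_scale) auto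
  then have "span ?E = span B"
    using C by (simp add: span_delete_0)
  moreover have "pairwise orthogonal ?E"
    using C(3) by (auto simp: pairwise_def orthogonal_def)
  moreover have "finite ?E"
    using C(1) by simp
  moreover have "norm e = 1" if e: "e \<in> ?E" for e
  proof -
    obtain x where "x \<noteq> 0" "e = x /\<^sub>R norm x"
      using e by blast
    then show ?thesis by simp
  qed
  ultimately show ?thesis
    by (intro that[of ?E])
qed

lemma orthonormal_expansion:
  fixes E :: "'v::real_inner set"
  assumes "finite E" "pairwise orthogonal E" "\<And>e. e \<in> E \<Longrightarrow> norm e = 1" "x \<in> span E"
  shows "x = (\<Sum>e\<in>E. inner x e *\<^sub>R e)"
proof -
  obtain f where f: "x = (\<Sum>e\<in>E. f e *\<^sub>R e)"
    using assms by (auto simp: span_finite)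
  have "inner x e = f e" if "e \<in> E" for e
  proof -
    have "inner x e = (\<Sum>c\<in>E. f c * inner c e)"
      by (simp add: f inner_sum_left)
    also have "\<dots> = (\<Sum>c\<in>E. if c = e then f c else 0)"
      using that assms by (intro sum.cong)
        (auto simp: pairwise_def orthogonal_def power2_norm_eq_inner[symmetric])
    finally show ?thesis
      using that assms(1) by simp
  qed
  then show ?thesis
    using f by simp
qed

lemma compact_unit_sphere_span:
  fixes B :: "'v::real_inner set"
  assumes "finite B"
  shows "compact {x \<in> span B. norm x = 1}"
proof -
  obtain E where E: "finite E" "span E = span B" "pairwise orthogonal E"
    "\<And>e. e \<in> E \<Longrightarrow> norm e = 1"
    using orthonormal_basis_of_span[OF assms] by blast
  let ?K = "{\<Sum>e\<in>E. f e *\<^sub>R e | f. \<forall>e\<in>E. \<bar>f e\<bar> \<le> (1::real)}"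
  \<comment> \<open>By the Cauchy-Schwarz inequality a unit vector has coefficients in \<open>[-1, 1]\<close>.\<close>
  have "{x \<in> span B. norm x = 1} = ?K \<inter> sphere 0 1"
  proof (intro equalityI subsetI)
    fix x assume x: "x \<in> {x \<in> span B. norm x = 1}"
    then have "x = (\<Sum>e\<in>E. inner x e *\<^sub>R e)"
      using E by (intro orthonormal_expansion) auto
    moreover have "\<bar>inner x e\<bar> \<le> 1" if "e \<in> E" for e
      using Cauchy_Schwarz_ineq2[of x e] x E(4)[OF that] by simp
    ultimately have "x \<in> ?K" by blast
    then show "x \<in> ?K \<inter> sphere 0 1" using x by simp
  next
    fix x assume "x \<in> ?K \<inter> sphere 0 1"
    then have "x \<in> span E" "norm x = 1"
      by (auto intro: span_sum span_scale span_base)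
    then show "x \<in> {x \<in> span B. norm x = 1}" using E(2) by simp
  qed
  moreover have "closed (sphere (0::'v) 1)"
    unfolding sphere_def by (intro closed_Collect_eq continuous_intros)
  ultimately show ?thesis
    by (simp only:) (rule compact_Int_closed[OF compact_coefficient_box[OF E(1)]])
qed

section \<open>Symmetric operators on a subspace\<close>

locale symmetric_operator =
  fixes V :: "'v::real_inner set" and A :: "'v \<Rightarrow> 'v"
  assumes subspace: "subspace V"
    and maps_to: "x \<in> V \<Longrightarrow> A x \<in> V"
    and symmetric: "x \<in> V \<Longrightarrow> y \<in> V \<Longrightarrow> inner (A x) y = inner x (A y)"
begin

lemma eq_if_inner_eq:
  assumes "x \<in> V" "y \<in> V" "\<And>v. v \<in> V \<Longrightarrow> inner x v = inner y v"
  shows "x = y"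
proof -
  have "inner (x - y) (x - y) = 0"
    using assms(3)[OF subspace_diff[OF subspace assms(1,2)]] by (simp add: inner_diff_left)
  then show ?thesis by simp
qed

text \<open>
  Symmetry moves the operator to the other factor, where the scalar product is linear in the
  argument at hand; testing against all of \<open>V\<close> then determines the image.
\<close>

lemma linear_add:
  assumes "x \<in> V" "y \<in> V"
  shows "A (x + y) = A x + A y"
proof (rule eq_if_inner_eq)
  have xy: "x + y \<in> V"
    using assms by (rule subspace_add[OF subspace])
  show "A (x + y) \<in> V" "A x + A y \<in> V"
    using xy assms by (auto intro: maps_to subspace_add[OF subspace])
  show "inner (A (x + y)) v = inner (A x + A y) v" if "v \<in> V" for v
    unfolding inner_add_left symmetric[OF xy that] symmetric[OF assms(1) that]
      symmetric[OF assms(2) that] ..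
qed

lemma linear_scale:
  assumes "x \<in> V"
  shows "A (r *\<^sub>R x) = r *\<^sub>R A x"
proof (rule eq_if_inner_eq)
  have rx: "r *\<^sub>R x \<in> V"
    using assms by (rule subspace_scale[OF subspace])
  show "A (r *\<^sub>R x) \<in> V" "r *\<^sub>R A x \<in> V"
    using rx assms by (auto intro: maps_to subspace_scale[OF subspace])
  show "inner (A (r *\<^sub>R x)) v = inner (r *\<^sub>R A x) v" if "v \<in> V" for v
    unfolding inner_scaleR_left symmetric[OF rx that] symmetric[OF assms that] ..
qed

lemma shift: "symmetric_operator V (\<lambda>x. A x - r *\<^sub>R x)"
proof
  show "A x - r *\<^sub>R x \<in> V" if "x \<in> V" for x
    using that by (intro subspace_diff[OF subspace] maps_to subspace_scale[OF subspace])
  show "inner (A x - r *\<^sub>R x) y = inner x (A y - r *\<^sub>R y)" if "x \<in> V" "y \<in> V" for x y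
    using symmetric[OF that] by (simp add: inner_diff_left inner_diff_right)
qed (rule subspace)

text \<open>
  Moving from \<open>x\<close> by a small step \<open>-t A x\<close> changes the quadratic form by \<open>-2 t \<parallel>A x\<parallel>\<^sup>2 + O(t\<^sup>2)\<close>, so a
  zero of a nonnegative form can only occur where \<open>A x\<close> vanishes.
\<close>

lemma kernel_if_quadratic_form_zero:
  assumes nonneg: "\<And>v. v \<in> V \<Longrightarrow> 0 \<le> inner (A v) v"
    and x: "x \<in> V" "inner (A x) x = 0"
  shows "A x = 0"
proof (rule ccontr)
  assume "A x \<noteq> 0"
  define z where "z = A x"
  define q where "q = inner (A z) z"
  have z: "z \<in> V" "0 < inner z z"
    using x(1) \<open>A x \<noteq> 0\<close> by (auto simp: z_def maps_to)
  have q: "0 \<le> q"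
    using nonneg[OF z(1)] by (simp add: q_def)
  \<comment> \<open>For this \<open>t\<close> the quadratic term \<open>t\<^sup>2 q\<close> is at most half of the linear one.\<close>
  define t where "t = inner z z / (1 + q)"
  have t: "0 < t" "t * q \<le> inner z z"
    using z(2) q by (auto simp: t_def field_simps)
  have "inner (A (x + (- t) *\<^sub>R z)) (x + (- t) *\<^sub>R z)
      = inner (A x) x - t * inner (A x) z - t * inner (A z) x + t * t * q"
    using x(1) z(1) unfolding linear_add[OF x(1) subspace_scale[OF subspace z(1)]]
      linear_scale[OF z(1)]
    by (simp add: inner_diff_left inner_diff_right q_def algebra_simps)
  also have "\<dots> = t * (t * q - 2 * inner z z)"
    using x z(1) symmetric[OF z(1) x(1)] by (simp add: z_def algebra_simps)
  also have "\<dots> < 0"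
    using t z(2) by (intro mult_pos_neg) linarith+
  finally show False
    using nonneg[OF subspace_add[OF subspace x(1) subspace_scale[OF subspace z(1), of "- t"]]]
    by simp
qed

end

text \<open>
  In an orthonormal basis \<open>E\<close> symmetry gives \<open>A x = (\<Sum>e\<in>E. (x, A e) e)\<close>, a finite sum of continuous
  functions of \<open>x\<close>.
\<close>

lemma symmetric_operator_continuous_on:
  assumes "symmetric_operator V A" "V = span B" "finite B"
  shows "continuous_on V A"
proof -
  interpret symmetric_operator V A by fact
  obtain E where E: "finite E" "span E = V" "pairwise orthogonal E" "\<And>e. e \<in> E \<Longrightarrow> norm e = 1"
    using orthonormal_basis_of_span[OF assms(3)] assms(2) by metis
  have "A x = (\<Sum>e\<in>E. inner x (A e) *\<^sub>R e)" if "x \<in> V" for x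
  proof -
    have "A x = (\<Sum>e\<in>E. inner (A x) e *\<^sub>R e)"
      using E maps_to[OF that] by (intro orthonormal_expansion) auto
    also have "\<dots> = (\<Sum>e\<in>E. inner x (A e) *\<^sub>R e)"
      using E(2) that by (intro sum.cong) (auto simp: symmetric span_base)
    finally show ?thesis .
  qed
  moreover have "continuous_on V (\<lambda>x. \<Sum>e\<in>E. inner x (A e) *\<^sub>R e)"
    by (intro continuous_intros)
  ultimately show ?thesis
    by (simp cong: continuous_on_cong)
qed

text \<open>
  A minimiser of the quadratic form on the unit sphere is an eigenvector whose eigenvalue is the
  minimum, so the minimum is at least the smallest eigenvalue.
\<close>

lemma smallest_eigenvalue_le_quadratic_form:
  assumes "symmetric_operator V A" "V = span B" "finite B"
    and smallest: "smallest_eigenvalue_on V A l"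
    and x: "x \<in> V"
  shows "l * inner x x \<le> inner (A x) x"
proof (cases "x = 0")
  case False
  interpret symmetric_operator V A by fact
  let ?S = "{x \<in> V. norm x = 1}"
  have normalize: "y /\<^sub>R norm y \<in> ?S" if "y \<in> V" "y \<noteq> 0" for y
    using that by (simp add: subspace_scale[OF subspace])
  have "compact ?S"
    using compact_unit_sphere_span[OF assms(3)] assms(2) by simp
  moreover have "?S \<noteq> {}"
    using normalize[OF x False] by blast
  moreover have "continuous_on ?S (\<lambda>x. inner (A x) x)"
    by (intro continuous_intros continuous_on_subset[OF symmetric_operator_continuous_on[OF assms(1-3)]])
      auto
  ultimately obtain p where p: "p \<in> ?S" "\<And>y. y \<in> ?S \<Longrightarrow> inner (A p) p \<le> inner (A y) y"
    using continuous_attains_inf[of ?S "\<lambda>x. inner (A x) x"] by blast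
  define m where "m = inner (A p) p"
  interpret B: symmetric_operator V "\<lambda>x. A x - m *\<^sub>R x"
    by (rule shift)
  have bound: "m * inner y y \<le> inner (A y) y" if y: "y \<in> V" for y
  proof (cases "y = 0")
    case False
    have "m \<le> inner (A (y /\<^sub>R norm y)) (y /\<^sub>R norm y)"
      using p(2)[OF normalize[OF y False]] by (simp add: m_def)
    also have "\<dots> = inner (A y) y / inner y y"
      using y by (simp add: linear_scale dot_square_norm power2_eq_square divide_inverse mult.commute)
    finally show ?thesis
      using False by (simp add: pos_le_divide_eq)
  qed simp
  have "A p - m *\<^sub>R p = 0"
  proof (rule B.kernel_if_quadratic_form_zero)
    show "0 \<le> inner (A v - m *\<^sub>R v) v" if "v \<in> V" for v
      using bound[OF that] by (simp add: inner_diff_left)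
    show "p \<in> V" "inner (A p - m *\<^sub>R p) p = 0"
      using p(1) by (auto simp: m_def inner_diff_left dot_square_norm)
  qed
  then have "eigenpair_on V A m p"
    using p(1) by (auto simp: eigenpair_on_def)
  then have "l \<le> m"
    using smallest by (auto simp: smallest_eigenvalue_on_def)
  then have "l * inner x x \<le> m * inner x x"
    by (simp add: mult_right_mono)
  also have "\<dots> \<le> inner (A x) x"
    by (rule bound[OF x])
  finally show ?thesis .
qed simp

section \<open>The weighted scheme\<close>

text \<open>
  The weighted mean is \<open>s = (z + y) / 2 + (\<sigma> - 1/2) (z - y)\<close>, whence
  \<open>2 (z - y, s) = \<parallel>z\<parallel>\<^sup>2 - \<parallel>y\<parallel>\<^sup>2 + (2 \<sigma> - 1) \<parallel>z - y\<parallel>\<^sup>2\<close>. This is where \<open>\<sigma> \<ge> 1/2\<close> enters.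
\<close>

lemma norm_le_if_weighted_mean_dissipative:
  fixes y z :: "'v::real_inner"
  assumes "1 / 2 \<le> \<sigma>" "inner (z - y) (\<sigma> *\<^sub>R z + (1 - \<sigma>) *\<^sub>R y) \<le> 0"
  shows "norm z \<le> norm y"
proof -
  have "2 * inner (z - y) (\<sigma> *\<^sub>R z + (1 - \<sigma>) *\<^sub>R y)
      = (inner z z - inner y y) + (2 * \<sigma> - 1) * inner (z - y) (z - y)"
    by (simp add: inner_diff_left inner_diff_right inner_add_right inner_commute[of z y] algebra_simps)
  moreover have "0 \<le> (2 * \<sigma> - 1) * inner (z - y) (z - y)"
    using assms(1) by simp
  ultimately have "inner z z \<le> inner y y"
    using assms(2) by linarith
  then show ?thesis
    by (simp add: norm_le)
qed

lemma fm_scheme_step: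
  fixes A :: "'v::real_inner \<Rightarrow> 'v"
  assumes A: "symmetric_operator V A"
    and "0 < \<tau>" "y \<in> fm_scheme V A l \<sigma> \<tau> N w" "n < N"
  defines "z \<equiv> exp (l * \<tau>) *\<^sub>R y (Suc n)"
  defines "s \<equiv> \<sigma> *\<^sub>R z + (1 - \<sigma>) *\<^sub>R y n"
  shows "s \<in> V" "z - y n = - (\<tau> *\<^sub>R (A s - l *\<^sub>R s))"
proof -
  interpret symmetric_operator V A by fact
  have "y n \<in> V" "y (Suc n) \<in> V"
    using assms(3,4) by (auto simp: fm_scheme_def)
  then show "s \<in> V"
    by (simp add: s_def z_def subspace_add[OF subspace] subspace_scale[OF subspace])
  have "(z - y n) /\<^sub>R \<tau> + (A s - l *\<^sub>R s) = 0"
    using assms(3,4) by (simp add: fm_scheme_def s_def z_def)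
  then have "\<tau> *\<^sub>R ((z - y n) /\<^sub>R \<tau> + (A s - l *\<^sub>R s)) = 0"
    by simp
  then have "(z - y n) + \<tau> *\<^sub>R (A s - l *\<^sub>R s) = 0"
    using \<open>0 < \<tau>\<close> by (simp only: scaleR_add_right) simp
  then show "z - y n = - (\<tau> *\<^sub>R (A s - l *\<^sub>R s))"
    by (simp add: eq_neg_iff_add_eq_0)
qed

lemma fm_scheme_fundamental_mode_exact:
  fixes A :: "'v::real_inner \<Rightarrow> 'v"
  assumes A: "symmetric_operator V A" and eigen: "eigenpair_on V A l \<phi>" and "0 < \<tau>"
  shows "fundamental_mode_exact l \<phi> \<tau> N (fm_scheme V A l \<sigma> \<tau> N w)"
  unfolding fundamental_mode_exact_def
proof (intro ballI allI impI)
  fix y n assume y: "y \<in> fm_scheme V A l \<sigma> \<tau> N w" "n < N"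
  interpret symmetric_operator V A by fact
  let ?z = "exp (l * \<tau>) *\<^sub>R y (Suc n)"
  let ?s = "\<sigma> *\<^sub>R ?z + (1 - \<sigma>) *\<^sub>R y n"
  note step = fm_scheme_step[OF A \<open>0 < \<tau>\<close> y]
  have "inner (A ?s - l *\<^sub>R ?s) \<phi> = inner ?s (A \<phi> - l *\<^sub>R \<phi>)"
    using step(1) eigen by (simp only: eigenpair_on_def inner_diff_left inner_diff_right symmetric) simp
  also have "\<dots> = 0"
    using eigen by (simp add: eigenpair_on_def)
  finally have "inner (?z - y n) \<phi> = 0"
    unfolding step(2) by (simp only: inner_minus_left inner_scaleR_left mult_zero_right minus_zero)
  then have "exp (l * \<tau>) * inner (y (Suc n)) \<phi> = inner (y n) \<phi>"
    by (simp add: inner_diff_left)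
  then have "exp (- l * \<tau>) * inner (y n) \<phi> = (exp (- l * \<tau>) * exp (l * \<tau>)) * inner (y (Suc n)) \<phi>"
    by (metis mult.assoc)
  then show "inner (y (Suc n)) \<phi> = exp (- l * \<tau>) * inner (y n) \<phi>"
    by (simp flip: exp_add)
qed

lemma fm_scheme_norm_le:
  fixes A :: "'v::real_inner \<Rightarrow> 'v"
  assumes A: "symmetric_operator V A"
    and lower: "\<And>x. x \<in> V \<Longrightarrow> l * inner x x \<le> inner (A x) x"
    and "0 < \<tau>" "1 / 2 \<le> \<sigma>" and y: "y \<in> fm_scheme V A l \<sigma> \<tau> N w"
  shows "n \<le> N \<Longrightarrow> norm (y n) \<le> exp (- l * (real n * \<tau>)) * norm w"
proof (induction n)
  case 0
  then show ?case using y by (simp add: fm_scheme_def)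
next
  case (Suc n)
  let ?z = "exp (l * \<tau>) *\<^sub>R y (Suc n)"
  let ?s = "\<sigma> *\<^sub>R ?z + (1 - \<sigma>) *\<^sub>R y n"
  have n: "n < N" using Suc.prems by simp
  note step = fm_scheme_step[OF A \<open>0 < \<tau>\<close> y n]
  have "inner (?z - y n) ?s = - (\<tau> * (inner (A ?s) ?s - l * inner ?s ?s))"
    unfolding step(2) by (simp only: inner_minus_left inner_scaleR_left inner_diff_left)
  also have "\<dots> \<le> 0"
    using lower[OF step(1)] \<open>0 < \<tau>\<close> by (simp only: neg_le_0_iff_le) (rule mult_nonneg_nonneg; linarith)
  finally have "norm ?z \<le> norm (y n)"
    by (rule norm_le_if_weighted_mean_dissipative[OF \<open>1 / 2 \<le> \<sigma>\<close>])
  then have "exp (l * \<tau>) * norm (y (Suc n)) \<le> exp (- l * (real n * \<tau>)) * norm w"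
    using Suc n by simp
  then have "exp (- l * \<tau>) * (exp (l * \<tau>) * norm (y (Suc n)))
      \<le> exp (- l * \<tau>) * (exp (- l * (real n * \<tau>)) * norm w)"
    by (rule mult_left_mono) simp
  then show ?case
    by (simp add: mult.assoc[symmetric] distrib_right distrib_left flip: exp_add)
qed

text \<open>
  The sign of \<open>l\<close> is arbitrary: for \<open>l < 0\<close> solutions may grow, but on \<open>[0, T]\<close> by no more than the
  factor \<open>exp (\<bar>l\<bar> T)\<close>, which does not depend on the time step.
\<close>

lemma fm_scheme_unconditionally_stable:
  fixes A :: "'v::real_inner \<Rightarrow> 'v"
  assumes A: "symmetric_operator V A"
    and lower: "\<And>x. x \<in> V \<Longrightarrow> l * inner x x \<le> inner (A x) x"
    and "1 / 2 \<le> \<sigma>"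
  shows "unconditionally_stable V T (fm_scheme V A l \<sigma>)"
  unfolding unconditionally_stable_def
proof (intro exI[of _ "exp (\<bar>l\<bar> * T)"] allI ballI impI)
  fix \<tau> :: real and N n :: nat and w y
  assume asm: "0 < \<tau>" "real N * \<tau> = T" "y \<in> fm_scheme V A l \<sigma> \<tau> N w" "n \<le> N"
  have "norm (y n) \<le> exp (- l * (real n * \<tau>)) * norm w"
    using fm_scheme_norm_le[OF A lower] asm assms(3) by blast
  also have "\<dots> \<le> exp (\<bar>l\<bar> * T) * norm w"
  proof -
    have "- l * (real n * \<tau>) \<le> \<bar>l\<bar> * (real N * \<tau>)"
      using asm by (intro mult_mono) auto
    then show ?thesis
      using asm(2) by (intro mult_right_mono) auto
  qed
  finally show "norm (y n) \<le> exp (\<bar>l\<bar> * T) * norm w" .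
qed

section \<open>The discrete elliptic operator\<close>

lemma bilinear_form_commute: "bilinear_form \<Omega> k c \<mu> u v = bilinear_form \<Omega> k c \<mu> v u"
  unfolding bilinear_form_def by (simp only: mult.commute mult.left_commute)

lemma symmetric_operator_if_represents_form:
  assumes "subspace V" "represents_form_on V a A"
    and "\<And>u v. u \<in> V \<Longrightarrow> v \<in> V \<Longrightarrow> a u v = a v u"
  shows "symmetric_operator V A"
proof
  fix x y assume xy: "x \<in> V" "y \<in> V"
  then have "inner (A x) y = inner (A y) x"
    using assms(2,3) by (simp add: represents_form_on_def)
  then show "inner (A x) y = inner x (A y)"
    by (simp add: inner_commute)
qed (use assms in \<open>auto simp: represents_form_on_def\<close>)

theorem theorem1:
  fixes \<Omega> :: "(real ^ 'd) set"
    and k c \<mu> :: "real ^ 'd \<Rightarrow> real"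
    and \<kappa> \<delta> T \<tau> \<sigma> lam\<^sub>1 :: real
    and M N :: nat
    and V :: "(real ^ 'd) L2 set"
    and A :: "(real ^ 'd) L2 \<Rightarrow> (real ^ 'd) L2"
    and \<phi>\<^sub>1 w\<^sub>0 :: "(real ^ 'd) L2"
  assumes dim: "CARD('d) = 2 \<or> CARD('d) = 3"
    and domain: "bounded_domain \<Omega>" "piecewise_smooth_boundary \<Omega>"
    and smooth: "smooth_fun_on (closure \<Omega>) k" "smooth_fun_on (closure \<Omega>) c"
      "smooth_fun_on (closure \<Omega>) \<mu>"
    and k_ge: "0 < \<kappa>" "\<forall>x\<in>closure \<Omega>. \<kappa> \<le> k x"
    and mu_nonneg: "\<forall>x\<in>closure \<Omega>. 0 \<le> \<mu> x"
    and lower_bound: "\<forall>u\<in>H1 \<Omega>. \<delta> * (norm u)\<^sup>2 \<le> bilinear_form \<Omega> k c \<mu> u u"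
    and V: "V \<subseteq> H1 \<Omega>" "subspace_of_dim M V"
    and A: "represents_form_on V (bilinear_form \<Omega> k c \<mu>) A"
    and eigenvalue: "smallest_eigenvalue_on V A lam\<^sub>1"
    and eigenfunction: "eigenpair_on V A lam\<^sub>1 \<phi>\<^sub>1" "norm \<phi>\<^sub>1 = 1"
    and grid: "0 < \<tau>" "0 < N" "real N * \<tau> = T"
    and weight: "0 < \<sigma>" "\<sigma> \<le> 1"
    and initial: "w\<^sub>0 \<in> V"
  shows "fundamental_mode_exact lam\<^sub>1 \<phi>\<^sub>1 \<tau> N (fm_scheme V A lam\<^sub>1 \<sigma> \<tau> N w\<^sub>0) \<and>
    (1 / 2 \<le> \<sigma> \<longrightarrow>
      unconditionally_stable V T (fm_scheme V A lam\<^sub>1 \<sigma>) \<and>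
      (\<forall>y\<in>fm_scheme V A lam\<^sub>1 \<sigma> \<tau> N w\<^sub>0. \<forall>n<N.
        norm (y (Suc n)) \<le> exp (- lam\<^sub>1 * (real (Suc n) * \<tau>)) * norm w\<^sub>0))"
proof -
  obtain B where B: "finite B" "V = span B"
    using V(2) by (auto simp: subspace_of_dim_def)
  have sym: "symmetric_operator V A"
    by (rule symmetric_operator_if_represents_form[OF _ A]) (auto simp: B(2) intro: bilinear_form_commute)
  have lower: "lam\<^sub>1 * inner x x \<le> inner (A x) x" if "x \<in> V" for x
    by (rule smallest_eigenvalue_le_quadratic_form[OF sym B(2,1) eigenvalue that])
  have "norm (y (Suc n)) \<le> exp (- lam\<^sub>1 * (real (Suc n) * \<tau>)) * norm w\<^sub>0"
    if "1 / 2 \<le> \<sigma>" "y \<in> fm_scheme V A lam\<^sub>1 \<sigma> \<tau> N w\<^sub>0" "n < N" for y n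
    using fm_scheme_norm_le[OF sym lower grid(1) that(1,2), of "Suc n"] that(3) by simp
  then show ?thesis
    using fm_scheme_fundamental_mode_exact[OF sym eigenfunction(1) grid(1)]
      fm_scheme_unconditionally_stable[OF sym lower]
    by blast
qed

end
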